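(* Let $k\ge 2$, let $\mathbb{F}_k$ be the free group on $k$ generators, and let $\mathbb{F}_k^+\subset\mathbb{F}_k$ be the free semigroup (i.e. the set of all words in the generators, excluding their inverses). If $f\in\ell^2(\mathbb{F}_k^+)\subset\ell^2(\mathbb{F}_k)$ is supported on words of length $n$, then $f$ acts (via the left-regular representation on the full group $\mathbb{F}_k$) as a convolutor, with convolution norm \[ \|f\|_\ast\le 2^{10}\sqrt{e}\,\sqrt{n}\,\|f\|_2 . \]
   Context: The convolution norm is $\|f\|_\ast=\sup\{\|f\ast g\|_2 : g\in\ell^2(\mathbb{F}_k),\ \|g\|_2=1\}$, where $(f\ast g)(x)=\sum_{y}f(y)g(y^{-1}x)$; functions in $\ell^2(\mathbb{F}_k^+)$ are extended by zero to $\mathbb{F}_k$. *)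

theory Defs
  imports "HOL-Analysis.Analysis" "HOL-Algebra.Group"
begin

text \<open>
  The free group on \<open>k\<close> generators is realised as the set of reduced words. The letter
  \<open>(i, True)\<close> stands for the generator \<open>i < k\<close> and \<open>(i, False)\<close> for its inverse.
\<close>

type_synonym letter = "nat \<times> bool"

definition letter_inv :: "letter \<Rightarrow> letter" where
  "letter_inv a = (fst a, \<not> snd a)"

definition reduced :: "letter list \<Rightarrow> bool" where
  "reduced w \<longleftrightarrow> successively (\<lambda>a b. b \<noteq> letter_inv a) w"

definition push :: "letter \<Rightarrow> letter list \<Rightarrow> letter list" where
  "push a w = (if w \<noteq> [] \<and> hd w = letter_inv a then tl w else a # w)"

text \<open>
  For reduced \<open>u\<close> and \<open>v\<close>, \<open>foldr push u v\<close> is the reduced form of the concatenation \<open>u @ v\<close>: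
  the letters of \<open>u\<close>, last one first, are multiplied onto \<open>v\<close> from the left.
\<close>

definition free_group :: "nat \<Rightarrow> letter list monoid" where
  "free_group k =
    \<lparr>carrier = {w. reduced w \<and> set w \<subseteq> {..<k} \<times> UNIV},
     mult = (\<lambda>u v. foldr push u v),
     one = []\<rparr>"

text \<open>
  The subsemigroup generated by the generators. Words without inverse letters are automatically
  reduced, and the empty word, i.e. the identity of the group, is not a member.
\<close>

definition free_semigroup :: "nat \<Rightarrow> letter list set" where
  "free_semigroup k = {w. w \<noteq> [] \<and> set w \<subseteq> {..<k} \<times> {True}}"

text \<open>
  Elements of \<open>\<ell>\<^sup>2(A)\<close> are functions on the whole ambient type that vanish outside \<open>A\<close>. Hence
  \<open>ell2 A \<subseteq> ell2 B\<close> for \<open>A \<subseteq> B\<close> is extension by zero, and the norm need not mention \<open>A\<close>.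
\<close>

definition ell2 :: "'a set \<Rightarrow> ('a \<Rightarrow> complex) set" where
  "ell2 A = {f. (\<forall>x. x \<notin> A \<longrightarrow> f x = 0) \<and> (\<lambda>x. (cmod (f x))\<^sup>2) summable_on A}"

definition ell2_norm :: "('a \<Rightarrow> complex) \<Rightarrow> real" where
  "ell2_norm f = sqrt (\<Sum>\<^sub>\<infinity>x. (cmod (f x))\<^sup>2)"

definition convolution ::
    "('a, 'b) monoid_scheme \<Rightarrow> ('a \<Rightarrow> complex) \<Rightarrow> ('a \<Rightarrow> complex) \<Rightarrow> 'a \<Rightarrow> complex" where
  "convolution G f g x =
    (if x \<in> carrier G then \<Sum>\<^sub>\<infinity>y\<in>carrier G. f y * g (inv\<^bsub>G\<^esub> y \<otimes>\<^bsub>G\<^esub> x) else 0)"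

text \<open>
  The supremum in \<open>conv_norm\<close> is one of real numbers, so it is meaningful only when the set is
  bounded above; this boundedness is part of \<open>convolutor\<close>.
\<close>

definition convolutor :: "('a, 'b) monoid_scheme \<Rightarrow> ('a \<Rightarrow> complex) \<Rightarrow> bool" where
  "convolutor G f \<longleftrightarrow>
    (\<forall>g\<in>ell2 (carrier G). convolution G f g \<in> ell2 (carrier G)) \<and>
    bdd_above {ell2_norm (convolution G f g) | g. g \<in> ell2 (carrier G) \<and> ell2_norm g = 1}"

definition conv_norm :: "('a, 'b) monoid_scheme \<Rightarrow> ('a \<Rightarrow> complex) \<Rightarrow> real" where
  "conv_norm G f =
    Sup {ell2_norm (convolution G f g) | g. g \<in> ell2 (carrier G) \<and> ell2_norm g = 1}"

lemma letter_inv_letter_inv [simp]: "letter_inv (letter_inv a) = a"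
  by (simp add: letter_inv_def)

lemma reduced_Nil [simp]: "reduced []"
  by (simp add: reduced_def)

lemma reduced_Cons: "reduced (a # w) \<longleftrightarrow> reduced w \<and> (w \<noteq> [] \<longrightarrow> hd w \<noteq> letter_inv a)"
  by (auto simp: reduced_def successively_Cons)

lemma reduced_push: "reduced w \<Longrightarrow> reduced (push a w)"
  by (cases w) (auto simp: push_def reduced_Cons)

lemma push_push_inv: "reduced w \<Longrightarrow> push a (push (letter_inv a) w) = w"
  by (cases w) (auto simp: push_def reduced_Cons neq_Nil_conv)

lemma reduced_foldr_push: "reduced v \<Longrightarrow> reduced (foldr push u v)"
  by (induction u) (auto intro: reduced_push)

lemma set_push: "set (push a w) \<subseteq> insert a (set w)"
  by (cases w) (auto simp: push_def)

lemma set_foldr_push: "set (foldr push u v) \<subseteq> set u \<union> set v"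
  by (induction u) (use set_push in fastforce)+

lemma foldr_push_push:
  assumes "reduced w"
  shows "foldr push (push a u) w = push a (foldr push u w)"
proof (cases "u \<noteq> [] \<and> hd u = letter_inv a")
  case True
  then obtain u' where "u = letter_inv a # u'" by (cases u) auto
  then show ?thesis
    using push_push_inv[OF reduced_foldr_push[OF assms]] by (simp add: push_def[of a "letter_inv a # u'"])
qed (auto simp: push_def[of a u])

lemma foldr_push_assoc:
  "reduced w \<Longrightarrow> foldr push (foldr push u v) w = foldr push u (foldr push v w)"
  by (induction u) (auto simp: foldr_push_push)

lemma foldr_push_Nil: "reduced u \<Longrightarrow> foldr push u [] = u"
  by (induction u) (auto simp: reduced_Cons push_def)

lemma foldr_push_inverse:
  "reduced v \<Longrightarrow> foldr push (rev (map letter_inv u)) (foldr push u v) = v"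
proof (induction u arbitrary: v)
  case (Cons a u)
  then show ?case
    using push_push_inv[of "foldr push u v" "letter_inv a"] by (simp add: reduced_foldr_push)
qed simp

lemma group_free_group: "group (free_group k)"
proof (rule groupI)
  fix u assume u: "u \<in> carrier (free_group k)"
  let ?v = "foldr push (rev (map letter_inv u)) []"
  have "set ?v \<subseteq> {..<k} \<times> UNIV"
    using u set_foldr_push[of "rev (map letter_inv u)" "[]"]
    by (fastforce simp: free_group_def letter_inv_def)
  moreover have "foldr push ?v u = []"
    using u foldr_push_inverse[of "[]" u] by (simp add: free_group_def foldr_push_assoc foldr_push_Nil)
  ultimately show "\<exists>v\<in>carrier (free_group k). v \<otimes>\<^bsub>free_group k\<^esub> u = \<one>\<^bsub>free_group k\<^esub>"
    by (intro bexI[of _ ?v]) (auto simp: free_group_def reduced_foldr_push)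
next
  fix u v assume "u \<in> carrier (free_group k)" "v \<in> carrier (free_group k)"
  then show "u \<otimes>\<^bsub>free_group k\<^esub> v \<in> carrier (free_group k)"
    using set_foldr_push[of u v] by (auto simp: free_group_def reduced_foldr_push)
qed (auto simp: free_group_def foldr_push_assoc)

lemma free_semigroup_subset: "free_semigroup k \<subseteq> carrier (free_group k)"
proof
  fix w assume w: "w \<in> free_semigroup k"
  have "set w \<subseteq> {..<k} \<times> {True} \<Longrightarrow> reduced w"
    by (induction w) (auto simp: reduced_Cons letter_inv_def neq_Nil_conv)
  with w show "w \<in> carrier (free_group k)"
    by (auto simp: free_group_def free_semigroup_def)
qed

end

theory Submission
  imports Defs "HOL-Library.Sublist"
begin

text \<open>
  For a positive word \<open>w\<close> of length \<open>n\<close> and a reduced word \<open>z\<close>, let \<open>i\<close> be the length of the longest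
  common prefix, so \<open>w = u v\<close>, \<open>z = u y\<close> with \<open>length u = i\<close>, and \<open>w\<inverse> z\<close> has the reduced form \<open>v\<inverse> y\<close>.
  The part of the convolution operator belonging to a fixed \<open>i\<close> has norm at most \<open>\<parallel>f\<parallel>\<close>
  by Cauchy--Schwarz, because \<open>v\<inverse> y\<close> determines \<open>v\<close> and \<open>y\<close>. To add up the \<open>n + 1\<close> parts at the cost of
  a factor \<open>sqrt (n + 1)\<close> only, split them according to the first letter of \<open>y\<close>. If it is an
  inverse letter, then \<open>i\<close> is the number of leading generators of \<open>z\<close>, so the outputs of different
  parts have disjoint supports; otherwise \<open>n - i\<close> is the number of leading inverse letters of
  \<open>w\<inverse> z\<close>, so different parts depend on disjoint pieces of the input. Hence
  \<open>\<parallel>f\<parallel>\<^sub>* \<le> 2 sqrt (n + 1) \<parallel>f\<parallel>\<close>.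
\<close>

section \<open>Cancellation between positive words and reduced words\<close>

definition word_inv :: "letter list \<Rightarrow> letter list" where
  "word_inv w = rev (map letter_inv w)"

definition lcp_length :: "'a list \<Rightarrow> 'a list \<Rightarrow> nat" where
  "lcp_length w z = length (longest_common_prefix w z)"

lemma length_word_inv [simp]: "length (word_inv w) = length w"
  by (simp add: word_inv_def)

lemma inj_letter_inv: "inj letter_inv"
  by (metis injI letter_inv_letter_inv)

lemma word_inv_eq_iff [simp]: "word_inv v = word_inv w \<longleftrightarrow> v = w"
  by (simp add: word_inv_def inj_map_eq_map[OF inj_letter_inv])

lemma lcp_length_le: "lcp_length w z \<le> length w"
  unfolding lcp_length_def by (simp add: longest_common_prefix_prefix1 prefix_length_le)

lemma take_lcp_length: "take (lcp_length w z) w = take (lcp_length w z) z"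
  unfolding lcp_length_def by (induction w z rule: longest_common_prefix.induct) auto

lemma hd_drop_lcp_length:
  "drop (lcp_length w z) w \<noteq> [] \<Longrightarrow> drop (lcp_length w z) z \<noteq> [] \<Longrightarrow>
    hd (drop (lcp_length w z) w) \<noteq> hd (drop (lcp_length w z) z)"
  unfolding lcp_length_def by (induction w z rule: longest_common_prefix.induct) auto

lemma foldr_push_eq_append: "reduced (u @ v) \<Longrightarrow> foldr push u v = u @ v"
  by (induction u) (auto simp: reduced_Cons push_def)

lemma reduced_append_iff:
  "reduced (u @ v) \<longleftrightarrow>
    reduced u \<and> reduced v \<and> (u = [] \<or> v = [] \<or> hd v \<noteq> letter_inv (last u))"
  by (simp add: reduced_def successively_append_iff)

lemma reduced_word_inv: "reduced v \<Longrightarrow> reduced (word_inv v)"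
  unfolding reduced_def word_inv_def
  by (induction v rule: induct_list012)
    (auto simp: successively_append_iff successively_map successively_Cons)

lemma reduced_positive: "\<forall>a\<in>set w. snd a \<Longrightarrow> reduced w"
  by (induction w) (auto simp: reduced_Cons letter_inv_def neq_Nil_conv)

text \<open>The last letter of \<open>word_inv v\<close> is the inverse of \<open>hd v\<close>, so
  its junction with \<open>y\<close> could cancel only if \<open>v\<close> and \<open>y\<close> had
  the same first letter, which maximality of the common prefix excludes.\<close>

lemma foldr_push_word_inv:
  assumes w: "\<forall>a\<in>set w. snd a" and z: "reduced z" and i: "i = lcp_length w z"
  shows "foldr push (word_inv w) z = word_inv (drop i w) @ drop i z"
proof -
  define u v y where "u = take i w" and "v = drop i w" and "y = drop i z"
  have w_eq: "w = u @ v" and z_eq: "z = u @ y"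
    unfolding u_def v_def y_def i by (simp, metis append_take_drop_id take_lcp_length)
  have y: "reduced y" using z by (simp add: z_eq reduced_append_iff)
  have "\<forall>a\<in>set v. snd a" using w by (simp add: w_eq)
  then have "reduced (word_inv v)" by (simp add: reduced_positive reduced_word_inv)
  moreover have "hd y \<noteq> hd v" if "v \<noteq> []" "y \<noteq> []"
    using that hd_drop_lcp_length[of w z] by (simp add: v_def y_def i)
  ultimately have red: "reduced (word_inv v @ y)"
    using y by (auto simp: reduced_append_iff word_inv_def last_rev hd_map)
  have "foldr push (word_inv w) z = foldr push (word_inv v) (foldr push (word_inv u) (foldr push u y))"
    using z by (simp add: foldr_push_eq_append z_eq) (simp add: w_eq word_inv_def)
  also have "\<dots> = word_inv v @ y"
    using foldr_push_inverse[OF y, of u] red by (simp add: word_inv_def foldr_push_eq_append)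
  finally show ?thesis by (simp add: v_def y_def)
qed

definition leading_pos :: "letter list \<Rightarrow> nat" where
  "leading_pos x = length (takeWhile snd x)"

definition leading_neg :: "letter list \<Rightarrow> nat" where
  "leading_neg x = length (takeWhile (\<lambda>a. \<not> snd a) x)"

text \<open>The empty word does not count: pairs for which all of \<open>z\<close> cancels go to the
  class that is controlled by \<open>leading_neg\<close>.\<close>

definition starts_neg :: "letter list \<Rightarrow> bool" where
  "starts_neg y \<longleftrightarrow> y \<noteq> [] \<and> \<not> snd (hd y)"

text \<open>The common prefix consists of generators, and the next letter of \<open>z\<close> is an
  inverse letter, so the initial run of generators in \<open>z\<close> stops exactly where the
  prefix does.\<close>

lemma leading_pos_lcp_length:
  assumes w: "\<forall>a\<in>set w. snd a" and y: "starts_neg (drop (lcp_length w z) z)"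
  shows "leading_pos z = lcp_length w z"
proof -
  let ?i = "lcp_length w z"
  obtain a y' where ay: "drop ?i z = a # y'" "\<not> snd a"
    using y by (cases "drop ?i z") (auto simp: starts_neg_def)
  have "z = take ?i w @ a # y'"
    by (metis append_take_drop_id ay(1) take_lcp_length)
  moreover have "\<forall>b\<in>set (take ?i w). snd b" using w by (meson in_set_takeD)
  ultimately have "takeWhile snd z = take ?i w"
    using ay(2) by (metis append_Nil2 takeWhile.simps(2) takeWhile_append2)
  then show ?thesis using lcp_length_le[of w z] by (simp add: leading_pos_def)
qed

text \<open>Inverting a positive word yields inverse letters only, and \<open>y\<close> does not
  prolong this run. For \<open>v = drop i w\<close> the count is \<open>n - i\<close>, so the
  argument of \<open>G\<close> alone reveals \<open>i\<close>.\<close>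

lemma leading_neg_word_inv_append:
  assumes "\<forall>a\<in>set v. snd a" and "\<not> starts_neg y"
  shows "leading_neg (word_inv v @ y) = length v"
proof -
  have "\<forall>a\<in>set (word_inv v). \<not> snd a"
    using assms(1) by (auto simp: word_inv_def letter_inv_def)
  moreover have "takeWhile (\<lambda>a. \<not> snd a) y = []"
    using assms(2) by (cases y) (auto simp: starts_neg_def)
  ultimately show ?thesis by (simp add: leading_neg_def takeWhile_append)
qed

section \<open>The finite inequality\<close>

text \<open>The predicate \<open>Q\<close> stays abstract so that one bound serves both classes of
  pairs, and \<open>X\<close> so that it can be confined to the piece of the input that a block
  reads. For each \<open>z\<close> the majorant is a product of a function of
  \<open>take i z\<close> and a function of \<open>drop i z\<close>.\<close>

lemma block_bound:
  fixes F G :: "letter list \<Rightarrow> real"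
  assumes fin: "finite W" "finite Z" "finite X"
    and len: "\<And>w. w \<in> W \<Longrightarrow> length w = n"
    and Q: "\<And>w z. w \<in> W \<Longrightarrow> z \<in> Z \<Longrightarrow> Q w z \<Longrightarrow>
      take i w = take i z \<and> word_inv (drop i w) @ drop i z \<in> X"
  shows "(\<Sum>z\<in>Z. (\<Sum>w | w \<in> W \<and> Q w z. F w * G (word_inv (drop i w) @ drop i z))\<^sup>2)
    \<le> (\<Sum>w\<in>W. (F w)\<^sup>2) * (\<Sum>x\<in>X. (G x)\<^sup>2)"
proof -
  define A where "A u = (\<Sum>w | w \<in> W \<and> take i w = u. (F w)\<^sup>2)" for u
  define V where "V y = {v \<in> drop i ` W. word_inv v @ y \<in> X}" for y
  define B where "B y = (\<Sum>v\<in>V y. (G (word_inv v @ y))\<^sup>2)" for y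
  have finV: "finite (V y)" for y using fin by (simp add: V_def)
  have A0: "A u \<ge> 0" and B0: "B u \<ge> 0" for u by (auto simp: A_def B_def intro: sum_nonneg)
  have "(\<Sum>w | w \<in> W \<and> Q w z. F w * G (word_inv (drop i w) @ drop i z))\<^sup>2
      \<le> A (take i z) * B (drop i z)" if z: "z \<in> Z" for z
  proof -
    let ?S = "{w \<in> W. Q w z}"
    \<comment> \<open>All these \<open>w\<close> share the prefix \<open>take i z\<close>, so the
      suffix determines \<open>w\<close>.\<close>
    have inj: "inj_on (drop i) ?S"
    proof (rule inj_onI)
      fix w w' assume "w \<in> ?S" "w' \<in> ?S" "drop i w = drop i w'"
      then show "w = w'" by (metis (mono_tags, lifting) Q append_take_drop_id mem_Collect_eq z)
    qed
    have "(\<Sum>w\<in>?S. (F w)\<^sup>2) \<le> A (take i z)"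
      unfolding A_def using Q[OF _ z] fin by (intro sum_mono2) auto
    moreover have "(\<Sum>w\<in>?S. (G (word_inv (drop i w) @ drop i z))\<^sup>2)
        = (\<Sum>v\<in>drop i ` ?S. (G (word_inv v @ drop i z))\<^sup>2)"
      by (simp add: sum.reindex[OF inj])
    moreover have "\<dots> \<le> B (drop i z)"
      unfolding B_def using Q[OF _ z] finV by (intro sum_mono2) (auto simp: V_def)
    ultimately show ?thesis
      using Cauchy_Schwarz_ineq_sum[of F "\<lambda>w. G (word_inv (drop i w) @ drop i z)" ?S]
      by (smt (verit, best) A0 mult_mono sum_nonneg zero_le_power2)
  qed
  then have "(\<Sum>z\<in>Z. (\<Sum>w | w \<in> W \<and> Q w z. F w * G (word_inv (drop i w) @ drop i z))\<^sup>2)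
      \<le> (\<Sum>z\<in>Z. A (take i z) * B (drop i z))"
    by (rule sum_mono)
  \<comment> \<open>A word \<open>z\<close> is recovered from its two pieces, so passing to all
    pairs of pieces only adds nonnegative terms.\<close>
  also have "\<dots> \<le> (\<Sum>(u, y) \<in> take i ` Z \<times> drop i ` Z. A u * B y)"
    using fin A0 B0
    by (intro sum_le_included[where i = "\<lambda>(u, y). u @ y"]) (force intro: mult_nonneg_nonneg)+
  also have "\<dots> = (\<Sum>u\<in>take i ` Z. A u) * (\<Sum>y\<in>drop i ` Z. B y)"
    by (simp add: sum_product sum.cartesian_product)
  also have "\<dots> \<le> (\<Sum>w\<in>W. (F w)\<^sup>2) * (\<Sum>x\<in>X. (G x)\<^sup>2)"
  proof (rule mult_mono)
    \<comment> \<open>With the prefixes of \<open>W\<close> included, every \<open>w\<close> lies in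
      exactly one fibre.\<close>
    have "(\<Sum>u\<in>take i ` Z. A u) \<le> (\<Sum>u\<in>take i ` (Z \<union> W). A u)"
      using fin A0 by (intro sum_mono2) auto
    also have "\<dots> = (\<Sum>w\<in>W. (F w)\<^sup>2)"
      unfolding A_def using fin by (intro sum.group) auto
    finally show "(\<Sum>u\<in>take i ` Z. A u) \<le> (\<Sum>w\<in>W. (F w)\<^sup>2)" .
    let ?P = "SIGMA y:drop i ` Z. V y"
    \<comment> \<open>All suffixes \<open>v\<close> have the same length, which fixes where
      \<open>word_inv v @ y\<close> is to be cut.\<close>
    have inj: "inj_on (\<lambda>(y, v). word_inv v @ y) ?P"
    proof (rule inj_onI, clarsimp)
      fix y v y' v'
      assume "v \<in> V y" "v' \<in> V y'" and eq: "word_inv v @ y = word_inv v' @ y'"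
      then have "length v = length v'" using len by (auto simp: V_def)
      then show "y = y' \<and> v = v'" using eq by simp
    qed
    have "(\<Sum>y\<in>drop i ` Z. B y) = (\<Sum>(y, v)\<in>?P. (G (word_inv v @ y))\<^sup>2)"
      unfolding B_def using fin finV by (subst sum.Sigma) auto
    also have "\<dots> = (\<Sum>x\<in>(\<lambda>(y, v). word_inv v @ y) ` ?P. (G x)\<^sup>2)"
      by (subst sum.reindex[OF inj]) (simp add: case_prod_unfold)
    also have "\<dots> \<le> (\<Sum>x\<in>X. (G x)\<^sup>2)"
      using fin by (intro sum_mono2) (auto simp: V_def)
    finally show "(\<Sum>y\<in>drop i ` Z. B y) \<le> (\<Sum>x\<in>X. (G x)\<^sup>2)" .
  qed (auto intro!: sum_nonneg A0 B0)
  finally show ?thesis .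
qed

text \<open>Each of the two classes of pairs contributes a factor \<open>n + 1\<close>; joining them
  by (a + b)^2 \<le> 2 a^2 + 2 b^2 gives the constant 4.\<close>

lemma finite_convolution_bound:
  fixes F G :: "letter list \<Rightarrow> real"
  assumes fin: "finite W" "finite Z"
    and pos: "\<And>w. w \<in> W \<Longrightarrow> \<forall>a\<in>set w. snd a"
    and len: "\<And>w. w \<in> W \<Longrightarrow> length w = n"
    and red: "\<And>z. z \<in> Z \<Longrightarrow> reduced z"
    and X: "X = (\<lambda>(w, z). foldr push (word_inv w) z) ` (W \<times> Z)"
  shows "(\<Sum>z\<in>Z. (\<Sum>w\<in>W. F w * G (foldr push (word_inv w) z))\<^sup>2)
    \<le> 4 * real (n + 1) * (\<Sum>w\<in>W. (F w)\<^sup>2) * (\<Sum>x\<in>X. (G x)\<^sup>2)"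
proof -
  define N where "N = (\<Sum>w\<in>W. (F w)\<^sup>2) * (\<Sum>x\<in>X. (G x)\<^sup>2)"
  define x where "x i w z = word_inv (drop i w) @ drop i z" for i and w z :: "letter list"
  define Neg where "Neg i w z \<longleftrightarrow> lcp_length w z = i \<and> starts_neg (drop i z)"
    for i and w z :: "letter list"
  define Pos where "Pos i w z \<longleftrightarrow> lcp_length w z = i \<and> \<not> starts_neg (drop i z)"
    for i and w z :: "letter list"
  define s1 where "s1 i z = (\<Sum>w | w \<in> W \<and> Neg i w z. F w * G (x i w z))" for i z
  define s2 where "s2 i z = (\<Sum>w | w \<in> W \<and> Pos i w z. F w * G (x i w z))" for i z
  have finX: "finite X" using fin by (simp add: X)
  have x_eq: "foldr push (word_inv w) z = x (lcp_length w z) w z" if "w \<in> W" "z \<in> Z" for w z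
    unfolding x_def using foldr_push_word_inv[OF pos[OF that(1)] red[OF that(2)] refl] .
  have xX: "x (lcp_length w z) w z \<in> X" if "w \<in> W" "z \<in> Z" for w z
    using that x_eq[OF that] by (force simp: X)
  have lcp_in: "lcp_length w z \<in> {..n}" if "w \<in> W" for w z
    using lcp_length_le[of w z] len[OF that] by simp
  have split: "(\<Sum>w\<in>W. F w * G (foldr push (word_inv w) z)) = (\<Sum>i\<le>n. s1 i z) + (\<Sum>i\<le>n. s2 i z)"
    if z: "z \<in> Z" for z
  proof -
    have "(\<Sum>w\<in>W. F w * G (foldr push (word_inv w) z))
        = (\<Sum>i\<le>n. \<Sum>w | w \<in> W \<and> lcp_length w z = i. F w * G (foldr push (word_inv w) z))"
      using fin lcp_in by (intro sum.group[symmetric]) auto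
    also have "\<dots> = (\<Sum>i\<le>n. s1 i z + s2 i z)"
    proof (rule sum.cong[OF refl])
      fix i assume "i \<in> {..n}"
      have "(\<Sum>w | w \<in> W \<and> lcp_length w z = i. F w * G (foldr push (word_inv w) z))
          = (\<Sum>w | w \<in> W \<and> lcp_length w z = i. F w * G (x i w z))"
        using z by (intro sum.cong) (auto simp: x_eq)
      also have "\<dots> = (\<Sum>w\<in>{w \<in> W. Neg i w z} \<union> {w \<in> W. Pos i w z}. F w * G (x i w z))"
        by (intro sum.cong) (auto simp: Neg_def Pos_def)
      also have "\<dots> = s1 i z + s2 i z"
        unfolding s1_def s2_def using fin
        by (intro sum.union_disjoint) (auto simp: Neg_def Pos_def)
      finally show "(\<Sum>w | w \<in> W \<and> lcp_length w z = i. F w * G (foldr push (word_inv w) z))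
          = s1 i z + s2 i z" .
    qed
    finally show ?thesis by (simp add: sum.distrib)
  qed
  have bound1: "(\<Sum>z\<in>Z. (\<Sum>i\<le>n. s1 i z)\<^sup>2) \<le> real (n + 1) * N"
  proof -
    \<comment> \<open>For given \<open>z\<close> at most one \<open>i\<close> contributes, so
      squaring produces no cross terms. The factor \<open>n + 1\<close> arises only from adding the
      \<open>n + 1\<close> block bounds.\<close>
    have zero: "s1 i z = 0" if "i \<noteq> leading_pos z" for i z
    proof -
      have "{w \<in> W. Neg i w z} = {}"
        using that leading_pos_lcp_length[OF pos] by (force simp: Neg_def)
      then show ?thesis unfolding s1_def by (metis sum.empty)
    qed
    have "(\<Sum>i\<le>n. s1 i z)\<^sup>2 \<le> (\<Sum>i\<le>n. (s1 i z)\<^sup>2)" for z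
    proof -
      have "(\<Sum>i\<le>n. s1 i z) = (\<Sum>i\<le>n. if i = leading_pos z then s1 i z else 0)"
        using zero by (intro sum.cong) auto
      moreover have "(\<Sum>i\<le>n. (s1 i z)\<^sup>2) = (\<Sum>i\<le>n. if i = leading_pos z then (s1 i z)\<^sup>2 else 0)"
        using zero by (intro sum.cong) auto
      ultimately show ?thesis by simp
    qed
    then have "(\<Sum>z\<in>Z. (\<Sum>i\<le>n. s1 i z)\<^sup>2) \<le> (\<Sum>z\<in>Z. \<Sum>i\<le>n. (s1 i z)\<^sup>2)"
      by (intro sum_mono)
    also have "\<dots> = (\<Sum>i\<le>n. \<Sum>z\<in>Z. (s1 i z)\<^sup>2)" by (rule sum.swap)
    also have "\<dots> \<le> (\<Sum>i\<le>n. N)"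
    proof (rule sum_mono)
      fix i
      show "(\<Sum>z\<in>Z. (s1 i z)\<^sup>2) \<le> N"
        unfolding s1_def N_def x_def
        using take_lcp_length xX
        by (intro block_bound[OF fin finX len]) (auto simp: Neg_def x_def)
    qed
    finally show ?thesis by simp
  qed
  have bound2: "(\<Sum>z\<in>Z. (\<Sum>i\<le>n. s2 i z)\<^sup>2) \<le> real (n + 1) * N"
  proof -
    \<comment> \<open>Here the factor \<open>n + 1\<close> comes from Cauchy--Schwarz over
      \<open>i\<close>. The sets \<open>Y i\<close> are disjoint because \<open>n - i\<close> is
      injective for \<open>i \<le> n\<close>, so the block bounds add up without further
      loss.\<close>
    define Y where "Y i = {y \<in> X. leading_neg y = n - i}" for i
    have "(\<Sum>i\<le>n. s2 i z)\<^sup>2 \<le> real (n + 1) * (\<Sum>i\<le>n. (s2 i z)\<^sup>2)" for z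
      using sum_squared_le_sum_of_squares[of "\<lambda>i. s2 i z" "{..n}"] by (simp add: mult.commute)
    then have "(\<Sum>z\<in>Z. (\<Sum>i\<le>n. s2 i z)\<^sup>2) \<le> (\<Sum>z\<in>Z. real (n + 1) * (\<Sum>i\<le>n. (s2 i z)\<^sup>2))"
      by (intro sum_mono)
    also have "\<dots> = real (n + 1) * (\<Sum>i\<le>n. \<Sum>z\<in>Z. (s2 i z)\<^sup>2)"
      by (simp only: sum_distrib_left[symmetric] sum.swap[of _ "{..n}" Z])
    also have "(\<Sum>i\<le>n. \<Sum>z\<in>Z. (s2 i z)\<^sup>2)
        \<le> (\<Sum>i\<le>n. (\<Sum>w\<in>W. (F w)\<^sup>2) * (\<Sum>y\<in>Y i. (G y)\<^sup>2))"
    proof (rule sum_mono)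
      fix i
      have "leading_neg (x i w z) = n - i" if "w \<in> W" "Pos i w z" for w z
      proof -
        have "\<forall>a\<in>set (drop i w). snd a" using pos[OF that(1)] by (meson in_set_dropD)
        then show ?thesis
          unfolding x_def using that len leading_neg_word_inv_append by (simp add: Pos_def)
      qed
      then show "(\<Sum>z\<in>Z. (s2 i z)\<^sup>2) \<le> (\<Sum>w\<in>W. (F w)\<^sup>2) * (\<Sum>y\<in>Y i. (G y)\<^sup>2)"
        unfolding s2_def x_def
        using take_lcp_length xX finX
        by (intro block_bound[OF fin _ len]) (auto simp: Pos_def x_def Y_def)
    qed
    also have "\<dots> = (\<Sum>w\<in>W. (F w)\<^sup>2) * (\<Sum>i\<le>n. \<Sum>y\<in>Y i. (G y)\<^sup>2)"
      by (simp add: sum_distrib_left)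
    also have "(\<Sum>i\<le>n. \<Sum>y\<in>Y i. (G y)\<^sup>2) = (\<Sum>y\<in>(\<Union>i\<le>n. Y i). (G y)\<^sup>2)"
      using finX by (intro sum.UNION_disjoint[symmetric]) (auto simp: Y_def)
    also have "\<dots> \<le> (\<Sum>y\<in>X. (G y)\<^sup>2)"
      using finX by (intro sum_mono2) (auto simp: Y_def)
    finally show ?thesis by (simp add: N_def mult_left_mono sum_nonneg)
  qed
  have "(\<Sum>z\<in>Z. (\<Sum>w\<in>W. F w * G (foldr push (word_inv w) z))\<^sup>2)
      \<le> (\<Sum>z\<in>Z. 2 * (\<Sum>i\<le>n. s1 i z)\<^sup>2 + 2 * (\<Sum>i\<le>n. s2 i z)\<^sup>2)"
  proof (rule sum_mono)
    fix z assume "z \<in> Z"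
    then show "(\<Sum>w\<in>W. F w * G (foldr push (word_inv w) z))\<^sup>2
        \<le> 2 * (\<Sum>i\<le>n. s1 i z)\<^sup>2 + 2 * (\<Sum>i\<le>n. s2 i z)\<^sup>2"
      using sum_squares_bound[of "\<Sum>i\<le>n. s1 i z" "\<Sum>i\<le>n. s2 i z"]
      by (simp add: split power2_sum)
  qed
  also have "\<dots> = 2 * (\<Sum>z\<in>Z. (\<Sum>i\<le>n. s1 i z)\<^sup>2) + 2 * (\<Sum>z\<in>Z. (\<Sum>i\<le>n. s2 i z)\<^sup>2)"
    by (simp add: sum.distrib sum_distrib_left)
  also have "\<dots> \<le> 4 * (real (n + 1) * N)" using bound1 bound2 by linarith
  finally show ?thesis by (simp only: N_def mult.assoc)
qed

section \<open>Passage to the limit\<close>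

lemma inv_free_group:
  assumes "w \<in> carrier (free_group k)"
  shows "inv\<^bsub>free_group k\<^esub> w = word_inv w"
proof -
  interpret group "free_group k" by (rule group_free_group)
  have "word_inv w \<otimes>\<^bsub>free_group k\<^esub> w = \<one>\<^bsub>free_group k\<^esub>"
    using assms foldr_push_inverse[of "[]" w]
    by (simp add: free_group_def word_inv_def foldr_push_Nil)
  moreover have "word_inv w \<in> carrier (free_group k)"
    using assms reduced_word_inv[of w] by (fastforce simp: free_group_def word_inv_def letter_inv_def)
  ultimately show ?thesis using assms by (simp add: inv_equality)
qed

lemma sum_le_ell2_norm_sq:
  assumes "f \<in> ell2 A" and "finite X"
  shows "(\<Sum>x\<in>X. (cmod (f x))\<^sup>2) \<le> (ell2_norm f)\<^sup>2"
proof -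
  have "(\<lambda>x. (cmod (f x))\<^sup>2) summable_on A \<longleftrightarrow> (\<lambda>x. (cmod (f x))\<^sup>2) summable_on UNIV"
    using assms by (intro summable_on_cong_neutral) (auto simp: ell2_def)
  then have "(\<lambda>x. (cmod (f x))\<^sup>2) summable_on UNIV"
    using assms by (simp add: ell2_def)
  then show ?thesis
    using assms by (simp add: ell2_norm_def infsum_nonneg finite_sum_le_infsum)
qed

lemma ell2I_finite_bound:
  assumes "\<And>x. x \<notin> A \<Longrightarrow> f x = 0"
    and bound: "\<And>Z. finite Z \<Longrightarrow> Z \<subseteq> A \<Longrightarrow> (\<Sum>x\<in>Z. (cmod (f x))\<^sup>2) \<le> C\<^sup>2" and "0 \<le> C"
  shows "f \<in> ell2 A" and "ell2_norm f \<le> C"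
proof -
  have sm: "(\<lambda>x. (cmod (f x))\<^sup>2) summable_on A"
    using bound by (intro nonneg_bdd_above_summable_on bdd_aboveI[where M = "C\<^sup>2"]) auto
  then show "f \<in> ell2 A" using assms by (simp add: ell2_def)
  have "(\<Sum>\<^sub>\<infinity>x. (cmod (f x))\<^sup>2) = (\<Sum>\<^sub>\<infinity>x\<in>A. (cmod (f x))\<^sup>2)"
    using assms by (intro infsum_cong_neutral) auto
  also have "\<dots> \<le> C\<^sup>2" using sm bound by (rule infsum_le_finite_sums)
  finally show "ell2_norm f \<le> C"
    unfolding ell2_norm_def using \<open>0 \<le> C\<close> by (simp add: real_le_lsqrt infsum_nonneg)
qed

lemma convolution_free_group_bound:
  assumes f: "f \<in> ell2 (free_semigroup k)" and len: "\<And>w. f w \<noteq> 0 \<Longrightarrow> length w = n"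
    and g: "g \<in> ell2 (carrier (free_group k))"
  defines "C \<equiv> 2 * sqrt (real (n + 1)) * ell2_norm f * ell2_norm g"
  shows "convolution (free_group k) f g \<in> ell2 (carrier (free_group k))"
    and "ell2_norm (convolution (free_group k) f g) \<le> C"
proof -
  let ?G = "carrier (free_group k)" and ?h = "convolution (free_group k) f g"
  define S where "S = {w. f w \<noteq> 0}"
  define t where "t z w = f w * g (foldr push (word_inv w) z)" for z w
  have S: "S \<subseteq> free_semigroup k" using f by (auto simp: S_def ell2_def)
  then have SG: "S \<subseteq> ?G" using free_semigroup_subset by blast
  have C0: "0 \<le> C" by (simp add: C_def ell2_norm_def infsum_nonneg)
  \<comment> \<open>Moduli are taken inside the sum over \<open>w\<close>, so that this estimate
    gives absolute convergence at a point (with \<open>Z = {z}\<close>) as well as the norm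
    bound.\<close>
  have fin_bound: "(\<Sum>z\<in>Z. (\<Sum>w\<in>W. cmod (t z w))\<^sup>2) \<le> C\<^sup>2"
    if "finite W" "W \<subseteq> S" "finite Z" "Z \<subseteq> ?G" for W Z
  proof -
    let ?X = "(\<lambda>(w, z). foldr push (word_inv w) z) ` (W \<times> Z)"
    have pos: "\<forall>a\<in>set w. snd a" if "w \<in> W" for w
      using that \<open>W \<subseteq> S\<close> S by (fastforce simp: free_semigroup_def)
    have "(\<Sum>z\<in>Z. (\<Sum>w\<in>W. cmod (t z w))\<^sup>2)
        \<le> 4 * real (n + 1) * (\<Sum>w\<in>W. (cmod (f w))\<^sup>2) * (\<Sum>x\<in>?X. (cmod (g x))\<^sup>2)"
      unfolding t_def norm_mult using that len pos
      by (intro finite_convolution_bound) (auto simp: free_group_def S_def)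
    also have "\<dots> \<le> 4 * real (n + 1) * (ell2_norm f)\<^sup>2 * (ell2_norm g)\<^sup>2"
      using that by (intro mult_mono sum_le_ell2_norm_sq[OF f] sum_le_ell2_norm_sq[OF g])
        (auto intro: sum_nonneg)
    also have "\<dots> = C\<^sup>2" by (simp add: C_def power_mult_distrib)
    finally show ?thesis .
  qed
  have lim: "(sum (t z) \<longlongrightarrow> ?h z) (finite_subsets_at_top S)" if z: "z \<in> ?G" for z
  proof -
    have "(\<Sum>w\<in>W. cmod (t z w)) \<le> C" if "finite W" "W \<subseteq> S" for W
      using fin_bound[OF that, of "{z}"] z C0 by (simp add: power2_le_iff_abs_le sum_nonneg)
    then have "(\<lambda>w. norm (t z w)) summable_on S"
      unfolding abs_summable_iff_bdd_above by (intro bdd_aboveI[where M = C]) auto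
    then have "(t z has_sum infsum (t z) S) S"
      by (simp add: abs_summable_summable)
    moreover have "infsum (t z) S = (\<Sum>\<^sub>\<infinity>y\<in>?G. f y * g (inv\<^bsub>free_group k\<^esub> y \<otimes>\<^bsub>free_group k\<^esub> z))"
    proof (rule infsum_cong_neutral)
      fix w assume "w \<in> S \<inter> ?G"
      then show "t z w = f w * g (inv\<^bsub>free_group k\<^esub> w \<otimes>\<^bsub>free_group k\<^esub> z)"
        by (simp add: inv_free_group t_def) (simp add: free_group_def)
    qed (use SG in \<open>auto simp: S_def\<close>)
    ultimately show ?thesis using z by (simp add: has_sum_def convolution_def)
  qed
  \<comment> \<open>For a fixed finite \<open>Z\<close> only finitely many limits are involved, and
    \<open>C\<close> does not depend on \<open>W\<close>, so the estimate survives as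
    \<open>W\<close> exhausts the support of \<open>f\<close>.\<close>
  have bound: "(\<Sum>z\<in>Z. (cmod (?h z))\<^sup>2) \<le> C\<^sup>2" if Z: "finite Z" "Z \<subseteq> ?G" for Z
  proof (rule tendsto_upperbound)
    show "((\<lambda>W. \<Sum>z\<in>Z. (cmod (sum (t z) W))\<^sup>2) \<longlongrightarrow> (\<Sum>z\<in>Z. (cmod (?h z))\<^sup>2))
        (finite_subsets_at_top S)"
      using Z lim by (intro tendsto_sum tendsto_power tendsto_norm) auto
    show "\<forall>\<^sub>F W in finite_subsets_at_top S. (\<Sum>z\<in>Z. (cmod (sum (t z) W))\<^sup>2) \<le> C\<^sup>2"
    proof (rule eventually_finite_subsets_at_top_weakI)
      fix W assume W: "finite W" "W \<subseteq> S"
      have "(\<Sum>z\<in>Z. (cmod (sum (t z) W))\<^sup>2) \<le> (\<Sum>z\<in>Z. (\<Sum>w\<in>W. cmod (t z w))\<^sup>2)"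
        by (intro sum_mono power_mono norm_sum) auto
      then show "(\<Sum>z\<in>Z. (cmod (sum (t z) W))\<^sup>2) \<le> C\<^sup>2" using fin_bound[OF W Z] by linarith
    qed
  qed simp
  have zero: "?h z = 0" if "z \<notin> ?G" for z using that by (simp add: convolution_def)
  show "?h \<in> ell2 ?G" and "ell2_norm ?h \<le> C"
    using ell2I_finite_bound[OF zero bound C0] by blast+
qed

theorem corollary1p4:
  fixes k n :: nat and f :: "letter list \<Rightarrow> complex"
  assumes "k \<ge> 2"
    and "f \<in> ell2 (free_semigroup k)"
    and "\<And>w. f w \<noteq> 0 \<Longrightarrow> length w = n"
  shows "convolutor (free_group k) f \<and>
    conv_norm (free_group k) f \<le> 2 ^ 10 * sqrt (exp 1) * sqrt (real n) * ell2_norm f"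
proof -
  let ?G = "carrier (free_group k)"
  let ?N = "{ell2_norm (convolution (free_group k) f g) | g. g \<in> ell2 ?G \<and> ell2_norm g = 1}"
  let ?K = "2 ^ 10 * sqrt (exp 1) * sqrt (real n) * ell2_norm f"
  have const: "2 * sqrt (real (n + 1)) * ell2_norm f \<le> ?K"
  proof (cases "n = 0")
    case True
    \<comment> \<open>The right-hand side vanishes for \<open>n = 0\<close>; the claim holds because
      the empty word is not in the semigroup.\<close>
    then have "f = (\<lambda>_. 0)"
      using assms(2,3) by (force simp: ell2_def free_semigroup_def)
    then show ?thesis by (simp add: ell2_norm_def)
  next
    case False
    \<comment> \<open>For \<open>n \<ge> 1\<close> one has \<open>n + 1 \<le> 4 * n\<close>, which
      leaves the constant 4, well below the required one.\<close>
    have "sqrt (real (n + 1)) \<le> sqrt (4 * real n)" using False by simp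
    then have "2 * sqrt (real (n + 1)) \<le> 4 * 1 * sqrt (real n)" by (simp add: real_sqrt_mult)
    also have "\<dots> \<le> 2 ^ 10 * sqrt (exp 1) * sqrt (real n)"
      by (intro mult_mono) auto
    finally show ?thesis by (intro mult_right_mono) (auto simp: ell2_norm_def infsum_nonneg)
  qed
  have bound: "a \<le> ?K" if a: "a \<in> ?N" for a
  proof -
    obtain g where "g \<in> ell2 ?G" "ell2_norm g = 1" "a = ell2_norm (convolution (free_group k) f g)"
      using a by blast
    then show ?thesis
      using convolution_free_group_bound(2)[OF assms(2,3), of g] const
      by (metis mult.right_neutral order_trans)
  qed
  \<comment> \<open>The unit mass at the identity shows that the supremum is taken over a nonempty
    set, as \<open>cSup_least\<close> requires.\<close>
  define e :: "letter list \<Rightarrow> complex" where "e x = (if x = [] then 1 else 0)" for x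
  have "e \<in> ell2 ?G"
    by (rule ell2I_finite_bound[where C = 1])
      (auto simp: e_def free_group_def if_distrib[of "\<lambda>c. (cmod c)\<^sup>2"] cong: if_cong)
  moreover have "ell2_norm e = 1"
  proof -
    have "(\<Sum>\<^sub>\<infinity>x. (cmod (e x))\<^sup>2) = (\<Sum>\<^sub>\<infinity>x\<in>{[]}. (cmod (e x))\<^sup>2)"
      by (rule infsum_cong_neutral) (auto simp: e_def)
    then show ?thesis by (simp add: ell2_norm_def e_def)
  qed
  ultimately have "?N \<noteq> {}" by blast
  then have "conv_norm (free_group k) f \<le> ?K"
    unfolding conv_norm_def using bound by (rule cSup_least)
  moreover have "bdd_above ?N"
    using bound by (rule bdd_aboveI)
  then have "convolutor (free_group k) f"
    unfolding convolutor_def using convolution_free_group_bound(1)[OF assms(2)] assms(3) by blast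
  ultimately show ?thesis by blast
qed

end
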